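(* Let $A$ be a commutative ring with nonzero identity, $E$ a nonzero unital $A$-module and $\delta$ an expansion function of ideals of $A$. Let $I$ be an ideal of $A$ and $F$ a submodule of $E$ such that $IE\subseteq F$. Then the following statements hold: (1) If $I\ltimes F$ is a $1$-absorbing $\delta_\ltimes$-primary ideal of $A\ltimes E$, then $I$ is a $1$-absorbing $\delta$-primary ideal of $A$. (2) Assume that $(F:c)=F$ for every $c\in A\setminus I$. Then $I\ltimes F$ is a $1$-absorbing $\delta_\ltimes$-primary ideal of $A\ltimes E$ if and only if $I$ is a $1$-absorbing $\delta$-primary ideal of $A$.
   Context: The trivial ring extension $A\ltimes E$ is the ring whose additive group is $A\oplus E$ with multiplication $(a,e)(b,f)=(ab,af+be)$. For an ideal $I$ of $A$ and a submodule $F$ of $E$, $I\ltimes F=\{(a,e): a\in I, e\in F\}$ is an ideal of $A\ltimes E$ if and only if $IE\subseteq F$. For $c\in A$, $(F:c)=\{e\in E\mid ce\in F\}$. For a commutative ring $T$ with nonzero identity, $\mathcal{I}(T)$ denotes the set of all ideals of $T$; a function $\delta:\mathcal{I}(T)\to\mathcal{I}(T)$ is an expansion function of ideals of $T$ if $L\subseteq\delta(L)$ for every ideal $L$, and $J\subseteq I$ implies $\delta(J)\subseteq\delta(I)$ for all ideals $I,J$. A proper ideal $I$ of $T$ is $1$-absorbing $\delta$-primary if whenever $a,b,c\in T$ are nonunits with $abc\in I$, then $ab\in I$ or $c\in\delta(I)$. Given an expansion function $\delta$ of ideals of $A$, $\delta_\ltimes$ is defined on ideals of $A\ltimes E$ of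 the form $I\ltimes F$ by $\delta_\ltimes(I\ltimes F)=\delta(I)\ltimes E$; being $1$-absorbing $\delta_\ltimes$-primary for $I\ltimes F$ depends only on this value. *)

theory Defs
  imports "HOL-Algebra.Module" "HOL-Algebra.Ideal"
begin

section \<open>Expansion functions and 1-absorbing primary ideals\<close>

text \<open>
  A function from the ideals of \<open>T\<close> to the ideals of \<open>T\<close> is rendered as a function on
  all subsets; only its values on ideals are constrained or used.
\<close>

definition expansion_function :: "('a, 'm) ring_scheme \<Rightarrow> ('a set \<Rightarrow> 'a set) \<Rightarrow> bool" where
  "expansion_function T \<delta> \<longleftrightarrow>
     (\<forall>L. ideal L T \<longrightarrow> ideal (\<delta> L) T \<and> L \<subseteq> \<delta> L) \<and>
     (\<forall>I J. ideal I T \<longrightarrow> ideal J T \<longrightarrow> J \<subseteq> I \<longrightarrow> \<delta> J \<subseteq> \<delta> I)"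

definition one_absorbing_primary ::
  "('a, 'm) ring_scheme \<Rightarrow> ('a set \<Rightarrow> 'a set) \<Rightarrow> 'a set \<Rightarrow> bool" where
  "one_absorbing_primary T \<delta> I \<longleftrightarrow>
     ideal I T \<and> I \<noteq> carrier T \<and>
     (\<forall>a \<in> carrier T - Units T. \<forall>b \<in> carrier T - Units T. \<forall>c \<in> carrier T - Units T.
        a \<otimes>\<^bsub>T\<^esub> b \<otimes>\<^bsub>T\<^esub> c \<in> I \<longrightarrow> a \<otimes>\<^bsub>T\<^esub> b \<in> I \<or> c \<in> \<delta> I)"


section \<open>Submodules attached to a module\<close>

text \<open>The submodule \<open>I E\<close>: all finite sums of products \<open>a e\<close> with \<open>a \<in> I\<close>.\<close>

definition ideal_smult :: "'a set \<Rightarrow> ('a, 'b, 'm) module_scheme \<Rightarrow> 'b set" where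
  "ideal_smult I E =
     {(\<Oplus>\<^bsub>E\<^esub>i \<in> {..<n}. a i \<odot>\<^bsub>E\<^esub> e i) | (n::nat) a e.
        a \<in> {..<n} \<rightarrow> I \<and> e \<in> {..<n} \<rightarrow> carrier E}"

definition submodule_colon :: "('a, 'b, 'm) module_scheme \<Rightarrow> 'b set \<Rightarrow> 'a \<Rightarrow> 'b set" where
  "submodule_colon E F c = {e \<in> carrier E. c \<odot>\<^bsub>E\<^esub> e \<in> F}"


section \<open>The trivial ring extension\<close>

text \<open>For subsets \<open>I\<close> and \<open>F\<close>, the set \<open>I \<ltimes> F\<close> is the product \<open>I \<times> F\<close>.\<close>

definition trivial_extension ::
  "('a, 'm) ring_scheme \<Rightarrow> ('a, 'b, 'n) module_scheme \<Rightarrow> ('a \<times> 'b) ring" where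
  "trivial_extension A E =
     \<lparr>carrier = carrier A \<times> carrier E,
      mult = (\<lambda>(a, e) (b, f). (a \<otimes>\<^bsub>A\<^esub> b, a \<odot>\<^bsub>E\<^esub> f \<oplus>\<^bsub>E\<^esub> b \<odot>\<^bsub>E\<^esub> e)),
      one = (\<one>\<^bsub>A\<^esub>, \<zero>\<^bsub>E\<^esub>),
      zero = (\<zero>\<^bsub>A\<^esub>, \<zero>\<^bsub>E\<^esub>),
      add = (\<lambda>(a, e) (b, f). (a \<oplus>\<^bsub>A\<^esub> b, e \<oplus>\<^bsub>E\<^esub> f))\<rparr>"

text \<open>
  The intended value at \<open>I \<ltimes> F\<close> is \<open>\<delta> I \<ltimes> E\<close>. Here \<open>I\<close> is recovered as the first
  projection; see the lemma \<open>delta_ext_Times\<close>.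
\<close>

definition delta_ext ::
  "('a, 'b, 'n) module_scheme \<Rightarrow> ('a set \<Rightarrow> 'a set) \<Rightarrow> ('a \<times> 'b) set \<Rightarrow> ('a \<times> 'b) set" where
  "delta_ext E \<delta> L = \<delta> (fst ` L) \<times> carrier E"

lemma delta_ext_Times:
  assumes "submodule F A E"
  shows "delta_ext E \<delta> (I \<times> F) = \<delta> I \<times> carrier E"
proof -
  have "\<zero>\<^bsub>E\<^esub> \<in> F"
    using subgroup.one_closed[OF submodule.axioms(1)[OF assms]] by simp
  then have "fst ` (I \<times> F) = I"
    by force
  then show ?thesis
    by (simp add: delta_ext_def)
qed

lemma (in module) cring_trivial_extension: "cring (trivial_extension R M)"
proof (intro cringI abelian_groupI comm_monoidI)
  fix x assume "x \<in> carrier (trivial_extension R M)"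
  then show "\<exists>y \<in> carrier (trivial_extension R M).
      y \<oplus>\<^bsub>trivial_extension R M\<^esub> x = \<zero>\<^bsub>trivial_extension R M\<^esub>"
    by (intro bexI[of _ "(\<ominus> fst x, \<ominus>\<^bsub>M\<^esub> snd x)"])
      (auto simp: trivial_extension_def R.l_neg M.l_neg)
qed (auto simp: trivial_extension_def R.m_assoc R.m_comm R.a_assoc R.a_comm M.a_assoc M.a_comm
      R.l_distr R.r_distr smult_l_distr smult_r_distr smult_assoc1[symmetric] M.a_lcomm R.a_lcomm R.m_lcomm)

end

theory Submission
  imports Defs
begin

text \<open>The second summand of the extension squares to zero, so (a, e) is a unit exactly when a
  is (\<open>Units_trivial_extension\<close>). Nonunits of the two rings thus correspond under the
  first projection, and \<open>delta_ext\<close> constrains only the first coordinate. Part (1),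
  \<open>one_absorbing_primary_base\<close>: the map r \<mapsto> (r, 0) is multiplicative and sends
  nonunits to nonunits, so a product in I is tested inside the extension. This also gives the
  forward direction of (2). Converse in (2), \<open>one_absorbing_primary_Times\<close>: let the
  product of (a, e), (b, f), (c, g) lie in I \<times> F with c \<notin> \<delta> I. Then ab \<in> I,
  and it remains to place h = af + be, the second coordinate of (a, e)(b, f), in F. The second
  coordinate of the triple product is (ab)g + ch; its first term is in IE \<subseteq> F, so ch \<in>
  F. Since I \<subseteq> \<delta> I, c \<notin> I, and (F : c) = F yields h \<in> F.\<close>

lemma one_absorbing_primaryD:
  assumes "one_absorbing_primary T \<delta> I"
    and "a \<in> carrier T - Units T" "b \<in> carrier T - Units T" "c \<in> carrier T - Units T"
    and "a \<otimes>\<^bsub>T\<^esub> b \<otimes>\<^bsub>T\<^esub> c \<in> I"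
  shows "a \<otimes>\<^bsub>T\<^esub> b \<in> I \<or> c \<in> \<delta> I"
proof -
  have "\<forall>a \<in> carrier T - Units T. \<forall>b \<in> carrier T - Units T. \<forall>c \<in> carrier T - Units T.
      a \<otimes>\<^bsub>T\<^esub> b \<otimes>\<^bsub>T\<^esub> c \<in> I \<longrightarrow> a \<otimes>\<^bsub>T\<^esub> b \<in> I \<or> c \<in> \<delta> I"
    using assms(1) unfolding one_absorbing_primary_def by (elim conjE)
  from this[rule_format, OF assms(2-5)] show ?thesis .
qed

context module
begin

text \<open>Projecting the inverse equations to the first coordinate gives one inclusion. For the
  other, the inverse of (a, e) is (a^-1, -a^-2 e).\<close>

lemma Units_trivial_extension:
  "Units (trivial_extension R M) = Units R \<times> carrier M"
proof (intro equalityI subsetI)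
  fix x assume "x \<in> Units (trivial_extension R M)"
  then show "x \<in> Units R \<times> carrier M"
    by (auto simp: Units_def trivial_extension_def)
next
  fix x assume "x \<in> Units R \<times> carrier M"
  then obtain a e where x: "x = (a, e)" and a: "a \<in> Units R" and e: "e \<in> carrier M"
    by blast
  have aR: "a \<in> carrier R" and inv: "inv a \<in> carrier R"
    using a by (simp_all add: R.Units_closed)
  \<comment> \<open>The second coordinate of (a, e)(a^-1, f) is af + a^-1 e; this f is the solution
    of af + a^-1 e = 0.\<close>
  define f where "f = \<ominus>\<^bsub>M\<^esub> (inv a \<odot>\<^bsub>M\<^esub> (inv a \<odot>\<^bsub>M\<^esub> e))"
  have f: "f \<in> carrier M"
    using e inv by (simp add: f_def)
  have "a \<odot>\<^bsub>M\<^esub> f = \<ominus>\<^bsub>M\<^esub> ((a \<otimes> inv a) \<odot>\<^bsub>M\<^esub> (inv a \<odot>\<^bsub>M\<^esub> e))"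
    using aR inv e by (simp add: f_def smult_r_minus smult_assoc1)
  also have "\<dots> = \<ominus>\<^bsub>M\<^esub> (inv a \<odot>\<^bsub>M\<^esub> e)"
    using a inv e by simp
  finally have af: "a \<odot>\<^bsub>M\<^esub> f = \<ominus>\<^bsub>M\<^esub> (inv a \<odot>\<^bsub>M\<^esub> e)" .
  show "x \<in> Units (trivial_extension R M)"
    unfolding Units_def x
    using a aR inv e f af
    by (auto simp: trivial_extension_def M.l_neg M.r_neg intro!: bexI[of _ "inv a"] bexI[of _ f])
qed

text \<open>A single product is a sum of length one. This turns IE \<subseteq> F into the
  elementwise condition \<open>IF\<close> used by the lemmas below.\<close>

lemma smult_mem_ideal_smult:
  assumes "I \<subseteq> carrier R" "a \<in> I" "e \<in> carrier M"
  shows "a \<odot>\<^bsub>M\<^esub> e \<in> ideal_smult I M"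
proof -
  have "a \<odot>\<^bsub>M\<^esub> e = (\<Oplus>\<^bsub>M\<^esub>i \<in> {..<1::nat}. a \<odot>\<^bsub>M\<^esub> e)"
    using assms by (auto simp: lessThan_Suc)
  then show ?thesis
    unfolding ideal_smult_def using assms
    by (intro CollectI exI[of _ "1::nat"] exI[of _ "\<lambda>_. a"] exI[of _ "\<lambda>_. e"]) simp
qed

text \<open>Absorption is where \<open>IF\<close> enters: (b, f)(a, e) has second coordinate be +
  af, with be \<in> F because F is a submodule and af \<in> F because a \<in> I.\<close>

lemma ideal_Times_trivial_extension:
  assumes I: "ideal I R" and F: "submodule F R M"
    and IF: "\<And>a e. a \<in> I \<Longrightarrow> e \<in> carrier M \<Longrightarrow> a \<odot>\<^bsub>M\<^esub> e \<in> F"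
  shows "ideal (I \<times> F) (trivial_extension R M)"
proof -
  interpret T: cring "trivial_extension R M" by (rule cring_trivial_extension)
  interpret I: ideal I R by (rule I)
  interpret F: submodule F R M by (rule F)
  have F_sub: "e \<in> carrier M" if "e \<in> F" for e
    using F.subset that by auto
  have F_add: "e \<oplus>\<^bsub>M\<^esub> f \<in> F" if "e \<in> F" "f \<in> F" for e f
    using F.m_closed[of e f] that by simp
  have F_zero: "\<zero>\<^bsub>M\<^esub> \<in> F"
    using F.one_closed by simp
  show ?thesis
  proof (rule idealI[OF T.ring_axioms])
    show "subgroup (I \<times> F) (add_monoid (trivial_extension R M))"
    proof (rule T.add.subgroupI)
      show "I \<times> F \<subseteq> carrier (trivial_extension R M)"
        using F_sub I.a_subset by (auto simp: trivial_extension_def)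
      show "I \<times> F \<noteq> {}"
        using F_zero I.zero_closed by blast
      show "\<ominus>\<^bsub>trivial_extension R M\<^esub> x \<in> I \<times> F" if x: "x \<in> I \<times> F" for x
      proof -
        obtain a e where ae: "x = (a, e)" "a \<in> I" "e \<in> F" using x by blast
        have c: "a \<in> carrier R" "e \<in> carrier M" using ae F_sub by auto
        have m: "\<ominus>\<^bsub>M\<^esub> e \<in> F"
          using F.m_inv_closed[of e] ae by (simp add: a_inv_def)
        have "\<ominus>\<^bsub>trivial_extension R M\<^esub> x = (\<ominus> a, \<ominus>\<^bsub>M\<^esub> e)"
          using c by (intro T.minus_equality)
            (auto simp: trivial_extension_def ae R.l_neg M.l_neg)
        then show ?thesis using m ae by simp
      qed
      show "x \<oplus>\<^bsub>trivial_extension R M\<^esub> y \<in> I \<times> F" if "x \<in> I \<times> F" "y \<in> I \<times> F" for x y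
        using that F_add by (auto simp: trivial_extension_def)
    qed
    fix x t assume x: "x \<in> I \<times> F" and t: "t \<in> carrier (trivial_extension R M)"
    then show tx: "t \<otimes>\<^bsub>trivial_extension R M\<^esub> x \<in> I \<times> F"
      using IF F_add F.smult_closed by (auto simp: trivial_extension_def I.I_l_closed)
    have "x \<in> carrier (trivial_extension R M)"
      using x F_sub by (auto simp: trivial_extension_def)
    with tx t show "x \<otimes>\<^bsub>trivial_extension R M\<^esub> t \<in> I \<times> F"
      by (simp add: T.m_comm)
  qed
qed

text \<open>Elements (r, 0) multiply like elements of R, and 0 \<in> F, so membership of their
  products in I \<times> F is decided in I alone.\<close>

lemma one_absorbing_primary_base:
  assumes I: "ideal I R" and F: "submodule F R M"
    and IF: "\<And>a e. a \<in> I \<Longrightarrow> e \<in> carrier M \<Longrightarrow> a \<odot>\<^bsub>M\<^esub> e \<in> F"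
    and prim: "one_absorbing_primary (trivial_extension R M) (delta_ext M \<delta>) (I \<times> F)"
  shows "one_absorbing_primary R \<delta> I"
  unfolding one_absorbing_primary_def
proof (intro conjI ballI impI)
  show "ideal I R" by (rule I)
  have F_sub: "F \<subseteq> carrier M" and F_zero: "\<zero>\<^bsub>M\<^esub> \<in> F"
    using subgroup.subset[OF submodule.axioms(1)[OF F]]
      subgroup.one_closed[OF submodule.axioms(1)[OF F]] by simp_all
  show "I \<noteq> carrier R"
  proof
    assume eq: "I = carrier R"
    \<comment> \<open>If 1 \<in> I, then e = 1e \<in> F for every e, so I \<times> F would be the
      whole extension.\<close>
    have "e \<in> F" if "e \<in> carrier M" for e
      using IF[of \<one> e] that eq by simp
    then have "I \<times> F = carrier (trivial_extension R M)"
      using F_sub eq by (auto simp: trivial_extension_def)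
    with prim show False by (simp add: one_absorbing_primary_def)
  qed
  fix a b c
  assume abc: "a \<in> carrier R - Units R" "b \<in> carrier R - Units R" "c \<in> carrier R - Units R"
    and "a \<otimes> b \<otimes> c \<in> I"
  let ?T = "trivial_extension R M"
  have nonunit: "(r, \<zero>\<^bsub>M\<^esub>) \<in> carrier ?T - Units ?T" if "r \<in> carrier R - Units R" for r
    using that unfolding Units_trivial_extension by (simp add: trivial_extension_def)
  have mult: "(r, \<zero>\<^bsub>M\<^esub>) \<otimes>\<^bsub>?T\<^esub> (s, \<zero>\<^bsub>M\<^esub>) = (r \<otimes> s, \<zero>\<^bsub>M\<^esub>)"
    if "r \<in> carrier R" "s \<in> carrier R" for r s
    using that by (simp add: trivial_extension_def)
  have "(a, \<zero>\<^bsub>M\<^esub>) \<otimes>\<^bsub>?T\<^esub> (b, \<zero>\<^bsub>M\<^esub>) \<otimes>\<^bsub>?T\<^esub> (c, \<zero>\<^bsub>M\<^esub>) \<in> I \<times> F"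
    using abc F_zero \<open>a \<otimes> b \<otimes> c \<in> I\<close> by (simp add: mult)
  then have "(a, \<zero>\<^bsub>M\<^esub>) \<otimes>\<^bsub>?T\<^esub> (b, \<zero>\<^bsub>M\<^esub>) \<in> I \<times> F \<or> (c, \<zero>\<^bsub>M\<^esub>) \<in> delta_ext M \<delta> (I \<times> F)"
    using prim nonunit[OF abc(1)] nonunit[OF abc(2)] nonunit[OF abc(3)]
    by (intro one_absorbing_primaryD)
  then show "a \<otimes> b \<in> I \<or> c \<in> \<delta> I"
    using abc by (auto simp: mult delta_ext_Times[OF F])
qed

text \<open>The colon condition allows c to be cancelled from ch \<in> F, which controls the second
  coordinate h of the product of the first two factors.\<close>

lemma one_absorbing_primary_Times:
  assumes I: "ideal I R" and F: "submodule F R M"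
    and IF: "\<And>a e. a \<in> I \<Longrightarrow> e \<in> carrier M \<Longrightarrow> a \<odot>\<^bsub>M\<^esub> e \<in> F"
    and \<delta>: "I \<subseteq> \<delta> I"
    and colon: "\<And>c. c \<in> carrier R - I \<Longrightarrow> submodule_colon M F c = F"
    and prim: "one_absorbing_primary R \<delta> I"
  shows "one_absorbing_primary (trivial_extension R M) (delta_ext M \<delta>) (I \<times> F)"
  unfolding one_absorbing_primary_def
proof (intro conjI ballI impI)
  let ?T = "trivial_extension R M"
  interpret F: submodule F R M by (rule F)
  show "ideal (I \<times> F) ?T"
    using I F IF by (rule ideal_Times_trivial_extension)
  have F_zero: "\<zero>\<^bsub>M\<^esub> \<in> F"
    using F.one_closed by simp
  have "I \<noteq> carrier R" using prim by (simp add: one_absorbing_primary_def)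
  \<comment> \<open>Equal products have equal factors unless they are empty; 0 \<in> F and I being
    an ideal proper in R leave no such coincidence.\<close>
  then show "I \<times> F \<noteq> carrier ?T"
    using F_zero by (auto simp: trivial_extension_def times_eq_iff)
  fix x y z
  assume nonunits:
      "x \<in> carrier ?T - Units ?T" "y \<in> carrier ?T - Units ?T" "z \<in> carrier ?T - Units ?T"
    and xyz: "x \<otimes>\<^bsub>?T\<^esub> y \<otimes>\<^bsub>?T\<^esub> z \<in> I \<times> F"
  obtain a e b f c g where x: "x = (a, e)" and y: "y = (b, f)" and z: "z = (c, g)"
    by (metis surj_pair)
  have abc: "a \<in> carrier R - Units R" "b \<in> carrier R - Units R" "c \<in> carrier R - Units R"
    and efg: "e \<in> carrier M" "f \<in> carrier M" "g \<in> carrier M"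
    using nonunits unfolding x y z Units_trivial_extension
    by (auto simp: trivial_extension_def)
  define h where "h = a \<odot>\<^bsub>M\<^esub> f \<oplus>\<^bsub>M\<^esub> b \<odot>\<^bsub>M\<^esub> e"
  have h: "h \<in> carrier M" using abc efg by (simp add: h_def)
  have xy: "x \<otimes>\<^bsub>?T\<^esub> y = (a \<otimes> b, h)"
    by (simp add: x y h_def trivial_extension_def)
  have I_mem: "a \<otimes> b \<otimes> c \<in> I" and F_mem: "(a \<otimes> b) \<odot>\<^bsub>M\<^esub> g \<oplus>\<^bsub>M\<^esub> c \<odot>\<^bsub>M\<^esub> h \<in> F"
    using xyz unfolding xy by (simp_all add: z trivial_extension_def)
  show "x \<otimes>\<^bsub>?T\<^esub> y \<in> I \<times> F \<or> z \<in> delta_ext M \<delta> (I \<times> F)"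
  proof (cases "c \<in> \<delta> I")
    case True
    then show ?thesis using efg by (simp add: z delta_ext_Times[OF F])
  next
    case False
    then have ab: "a \<otimes> b \<in> I"
      using one_absorbing_primaryD[OF prim abc I_mem] by blast
    let ?u = "(a \<otimes> b) \<odot>\<^bsub>M\<^esub> g"
    have u: "?u \<in> F" "?u \<in> carrier M"
      using IF ab efg abc by auto
    have ch: "c \<odot>\<^bsub>M\<^esub> h \<in> carrier M" using abc h by simp
    have "\<ominus>\<^bsub>M\<^esub> ?u \<in> F"
      using F.m_inv_closed[of ?u] u by (simp add: a_inv_def)
    \<comment> \<open>Subtracting (ab)g, which lies in F since ab \<in> I, isolates ch.\<close>
    then have "\<ominus>\<^bsub>M\<^esub> ?u \<oplus>\<^bsub>M\<^esub> (?u \<oplus>\<^bsub>M\<^esub> c \<odot>\<^bsub>M\<^esub> h) \<in> F"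
      using F.m_closed F_mem by simp
    then have "c \<odot>\<^bsub>M\<^esub> h \<in> F"
      using u ch by (simp add: M.r_neg1)
    \<comment> \<open>The case assumption c \<notin> \<delta> I gives c \<notin> I through I
      \<subseteq> \<delta> I, so the colon condition applies to c.\<close>
    moreover have "c \<in> carrier R - I" using False \<delta> abc by auto
    ultimately have "h \<in> F"
      using colon h unfolding submodule_colon_def by blast
    then show ?thesis using ab by (simp add: xy)
  qed
qed

end

theorem theorem2p30:
  fixes A :: "('a, 'm) ring_scheme"
    and E :: "('a, 'b, 'n) module_scheme"
    and \<delta> :: "'a set \<Rightarrow> 'a set"
    and I :: "'a set" and F :: "'b set"
  assumes "cring A" and "\<one>\<^bsub>A\<^esub> \<noteq> \<zero>\<^bsub>A\<^esub>"
    and "module A E" and "carrier E \<noteq> {\<zero>\<^bsub>E\<^esub>}"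
    and "expansion_function A \<delta>"
    and "ideal I A" and "submodule F A E"
    and "ideal_smult I E \<subseteq> F"
  shows "(one_absorbing_primary (trivial_extension A E) (delta_ext E \<delta>) (I \<times> F) \<longrightarrow>
            one_absorbing_primary A \<delta> I)
       \<and> ((\<forall>c \<in> carrier A - I. submodule_colon E F c = F) \<longrightarrow>
            (one_absorbing_primary (trivial_extension A E) (delta_ext E \<delta>) (I \<times> F) \<longleftrightarrow>
             one_absorbing_primary A \<delta> I))"
proof -
  interpret module A E by fact
  have I_sub: "I \<subseteq> carrier A"
    using \<open>ideal I A\<close> ideal.Icarr by auto
  have IF: "a \<odot>\<^bsub>E\<^esub> e \<in> F" if "a \<in> I" "e \<in> carrier E" for a e
    using smult_mem_ideal_smult[OF I_sub that] \<open>ideal_smult I E \<subseteq> F\<close> by blast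
  have "I \<subseteq> \<delta> I"
    using \<open>expansion_function A \<delta>\<close> \<open>ideal I A\<close> by (simp add: expansion_function_def)
  with one_absorbing_primary_base[OF \<open>ideal I A\<close> \<open>submodule F A E\<close> IF]
    one_absorbing_primary_Times[OF \<open>ideal I A\<close> \<open>submodule F A E\<close> IF]
  show ?thesis by blast
qed

end
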